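(* Let $M$ be a matroid on $S$ and $N$ a matroid on $T$, with $S\cap T=\emptyset$, and let $L=M\mathbin{\Box} N$ be their free product, a matroid on $S+T$. Then for any $U\subseteq S+T$ such that $|U|=|S|$ and $\rho_L(U)=\rho(M)$, there exist bijective weak maps $L|U\to M$ and $L/U\to N$.
   Context: Matroids are on finite ground sets. For a matroid $M$ on $S$ with rank function $\rho_M$, write $\rho(M)=\rho_M(S)$, $\nu_M(A)=|A|-\rho_M(A)$ (nullity) and $\lambda_M(A)=\rho(M)-\rho_M(A)$ (rank-lack) for $A\subseteq S$. $S+T$ denotes the disjoint union. For matroids $M$ on $S$ and $N$ on $T$, with $S\cap T=\emptyset$, the free product $M\mathbin{\Box} N$ is the matroid on $S+T$ whose independent sets are exactly those $A\subseteq S+T$ such that $A\cap S$ is independent in $M$ and $\lambda_M(A\cap S)\geq \nu_N(A\cap T)$ (this family is indeed the family of independent sets of a matroid). $L|U$ denotes the restriction of $L$ to $U$, and $L/U$ denotes the matroid on $(S+T)\setminus U$ obtained from $L$ by contracting $U$. A bijective weak map $P\to Q$ between matroids is a bijection $\phi$ from the ground set of $P$ to the ground set of $Q$ such that $\phi^{-1}(I)$ is independent in $P$ whenever $I$ is independent in $Q$. *)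

theory Defs
  imports Main
begin

record 'a matroid_structure =
  ground :: "'a set"
  indep :: "'a set \<Rightarrow> bool"

locale matroid =
  fixes M :: "'a matroid_structure"
  assumes finite_ground: "finite (ground M)"
    and indep_subset_ground: "indep M X \<Longrightarrow> X \<subseteq> ground M"
    and indep_empty: "indep M {}"
    and indep_subset: "indep M X \<Longrightarrow> Y \<subseteq> X \<Longrightarrow> indep M Y"
    and indep_exchange: "indep M X \<Longrightarrow> indep M Y \<Longrightarrow> card X < card Y \<Longrightarrow>
           \<exists>y\<in>Y - X. indep M (insert y X)"

definition rank :: "'a matroid_structure \<Rightarrow> 'a set \<Rightarrow> nat" where
  "rank M A = Max {card X |X. X \<subseteq> A \<and> indep M X}"

abbreviation total_rank :: "'a matroid_structure \<Rightarrow> nat" where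
  "total_rank M \<equiv> rank M (ground M)"

text \<open>The natural-number subtractions in \<open>nullity\<close> and \<open>rank_lack\<close> do not truncate
  when \<open>M\<close> is a matroid and \<open>A \<subseteq> ground M\<close>; see \<open>rank_le_card\<close> and \<open>rank_mono\<close>.\<close>

definition nullity :: "'a matroid_structure \<Rightarrow> 'a set \<Rightarrow> nat" where
  "nullity M A = card A - rank M A"

definition rank_lack :: "'a matroid_structure \<Rightarrow> 'a set \<Rightarrow> nat" where
  "rank_lack M A = total_rank M - rank M A"

text \<open>Only meaningful when the two ground sets are disjoint.\<close>

definition free_product ::
  "'a matroid_structure \<Rightarrow> 'a matroid_structure \<Rightarrow> 'a matroid_structure" where
  "free_product M N =
     \<lparr> ground = ground M \<union> ground N,
       indep = (\<lambda>A. A \<subseteq> ground M \<union> ground N \<and> indep M (A \<inter> ground M) \<and>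
                    rank_lack M (A \<inter> ground M) \<ge> nullity N (A \<inter> ground N)) \<rparr>"

definition restriction :: "'a matroid_structure \<Rightarrow> 'a set \<Rightarrow> 'a matroid_structure" where
  "restriction M U = \<lparr> ground = U, indep = (\<lambda>A. A \<subseteq> U \<and> indep M A) \<rparr>"

definition basis_of :: "'a matroid_structure \<Rightarrow> 'a set \<Rightarrow> 'a set \<Rightarrow> bool" where
  "basis_of M U B \<longleftrightarrow> B \<subseteq> U \<and> indep M B \<and> (\<forall>x\<in>U - B. \<not> indep M (insert x B))"

text \<open>The choice of the basis \<open>B\<close> of \<open>U\<close> is immaterial; see \<open>contraction_basis_irrelevant\<close>.\<close>

definition contraction :: "'a matroid_structure \<Rightarrow> 'a set \<Rightarrow> 'a matroid_structure" where
  "contraction M U =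
     \<lparr> ground = ground M - U,
       indep = (\<lambda>A. A \<subseteq> ground M - U \<and> (\<exists>B. basis_of M U B \<and> indep M (A \<union> B))) \<rparr>"

definition bijective_weak_map ::
  "'a matroid_structure \<Rightarrow> 'b matroid_structure \<Rightarrow> ('a \<Rightarrow> 'b) \<Rightarrow> bool" where
  "bijective_weak_map P Q \<phi> \<longleftrightarrow>
     bij_betw \<phi> (ground P) (ground Q) \<and>
     (\<forall>I. indep Q I \<longrightarrow> indep P (\<phi> -` I \<inter> ground P))"

context matroid
begin

lemma indep_finite: "indep M X \<Longrightarrow> finite X"
  using finite_ground indep_subset_ground finite_subset by blast

lemma finite_cards: "finite {card X |X. X \<subseteq> A \<and> indep M X}"
proof -
  have "{card X |X. X \<subseteq> A \<and> indep M X} \<subseteq> card ` Pow (ground M)"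
    using indep_subset_ground by blast
  thus ?thesis using finite_ground finite_subset by blast
qed

lemma card_le_rank: "indep M X \<Longrightarrow> X \<subseteq> A \<Longrightarrow> card X \<le> rank M A"
  unfolding rank_def by (rule Max_ge[OF finite_cards]) blast

lemma rank_attained: "\<exists>X. X \<subseteq> A \<and> indep M X \<and> card X = rank M A"
proof -
  have "{card X |X. X \<subseteq> A \<and> indep M X} \<noteq> {}" using indep_empty by blast
  from Max_in[OF finite_cards this] show ?thesis unfolding rank_def by auto
qed

lemma rank_mono: "A \<subseteq> B \<Longrightarrow> rank M A \<le> rank M B"
  by (metis rank_attained card_le_rank subset_trans)

lemma rank_le_card: "finite A \<Longrightarrow> rank M A \<le> card A"
  by (metis rank_attained card_mono)

lemma rank_indep: "indep M X \<Longrightarrow> rank M X = card X"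
  by (simp add: card_le_rank indep_finite le_antisym rank_le_card)

lemma nullity_mono:
  assumes "finite B" "A \<subseteq> B" shows "nullity M A \<le> nullity M B"
proof -
  obtain X where X: "X \<subseteq> B" "indep M X" "card X = rank M B" using rank_attained by blast
  have "card (X \<inter> A) \<le> rank M A" using X(2) indep_subset card_le_rank by blast
  moreover have "card X \<le> card (X \<inter> A) + card (B - A)"
  proof -
    have "card X \<le> card ((X \<inter> A) \<union> (B - A))"
      using X(1) assms finite_subset[of X B] finite_subset[of A B] by (intro card_mono) auto
    also have "\<dots> \<le> card (X \<inter> A) + card (B - A)" by (rule card_Un_le)
    finally show ?thesis .
  qed
  moreover have "card B = card A + card (B - A)"
    using assms finite_subset[OF assms(2,1)] card_mono[OF assms] by (simp add: card_Diff_subset)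
  ultimately show ?thesis using X(3) unfolding nullity_def by linarith
qed

lemma augment:
  assumes "indep M X" "indep M Y" "card X \<le> card Y"
  shows "\<exists>Z. X \<subseteq> Z \<and> Z \<subseteq> X \<union> Y \<and> indep M Z \<and> card Z = card Y"
  using assms
proof (induction "card Y - card X" arbitrary: X)
  case 0
  then show ?case by (intro exI[of _ X]) auto
next
  case (Suc n)
  have "card X < card Y" using Suc.hyps(2) by simp
  then obtain y where y: "y \<in> Y - X" "indep M (insert y X)"
    using indep_exchange Suc.prems by blast
  have c: "card (insert y X) = Suc (card X)" using y indep_finite[OF Suc.prems(1)] by simp
  have "n = card Y - card (insert y X)" "card (insert y X) \<le> card Y"
    using c Suc.hyps(2) by simp_all
  from Suc.hyps(1)[OF this(1) y(2) Suc.prems(2) this(2)]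
  obtain Z where "insert y X \<subseteq> Z" "Z \<subseteq> insert y X \<union> Y" "indep M Z" "card Z = card Y"
    by blast
  then show ?case using y by blast
qed

lemma basis_exists: "\<exists>B. basis_of M U B"
proof -
  obtain X where X: "X \<subseteq> U" "indep M X" "card X = rank M U" using rank_attained by blast
  have "\<not> indep M (insert x X)" if "x \<in> U - X" for x
    using card_le_rank[of "insert x X" U] X that indep_finite by fastforce
  thus ?thesis using X unfolding basis_of_def by blast
qed

lemma basis_card: "basis_of M U B \<Longrightarrow> card B = rank M U"
proof (rule ccontr)
  assume B: "basis_of M U B" and ne: "card B \<noteq> rank M U"
  obtain X where X: "X \<subseteq> U" "indep M X" "card X = rank M U" using rank_attained by blast
  have B': "B \<subseteq> U" "indep M B" "\<forall>x\<in>U - B. \<not> indep M (insert x B)"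
    using B by (simp_all add: basis_of_def)
  have "card B < card X" using card_le_rank[OF B'(2,1)] ne X(3) by simp
  then obtain y where "y \<in> X - B" "indep M (insert y B)"
    using indep_exchange[OF B'(2) X(2)] by blast
  then show False using B'(3) X(1) by blast
qed

lemma contraction_basis_irrelevant:
  assumes "A \<inter> U = {}" "basis_of M U B" "basis_of M U C" "indep M (A \<union> B)"
  shows "indep M (A \<union> C)"
proof -
  have fin: "finite (A \<union> B)" using assms(4) indep_finite by blast
  have C: "indep M C" "C \<subseteq> U" "B \<subseteq> U" using assms unfolding basis_of_def by auto
  have eq: "card C = card B" using assms basis_card by metis
  have "card C \<le> card (A \<union> B)" unfolding eq by (rule card_mono[OF fin]) simp
  then obtain Z where Z: "C \<subseteq> Z" "Z \<subseteq> C \<union> (A \<union> B)" "indep M Z" "card Z = card (A \<union> B)"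
    using augment[OF C(1) assms(4)] by blast
  have "x \<in> A \<union> C" if "x \<in> Z" for x
  proof (rule ccontr)
    assume "x \<notin> A \<union> C"
    hence "x \<in> U - C" using that Z C by blast
    moreover have "indep M (insert x C)" using Z that indep_subset[of Z "insert x C"] by blast
    ultimately show False using assms(3) unfolding basis_of_def by blast
  qed
  hence sub: "Z \<subseteq> A \<union> C" by blast
  have finC: "finite C" using C indep_finite by blast
  have "card (A \<union> C) = card A + card C" "card (A \<union> B) = card A + card B"
    using assms(1) C fin finC by (auto intro!: card_Un_disjoint)
  hence "card Z = card (A \<union> C)" using Z eq by simp
  hence "Z = A \<union> C" using sub fin finC by (simp add: card_subset_eq)
  thus ?thesis using Z by simp
qed

lemma matroid_restriction:
  assumes "U \<subseteq> ground M" shows "matroid (restriction M U)"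
proof
  show "finite (ground (restriction M U))"
    using assms finite_ground finite_subset by (auto simp: restriction_def)
  show "\<And>X. indep (restriction M U) X \<Longrightarrow> X \<subseteq> ground (restriction M U)"
    by (simp add: restriction_def)
  show "indep (restriction M U) {}" using indep_empty by (simp add: restriction_def)
  show "\<And>X Y. indep (restriction M U) X \<Longrightarrow> Y \<subseteq> X \<Longrightarrow> indep (restriction M U) Y"
    by (auto simp: restriction_def intro: indep_subset)
next
  fix X Y
  assume "indep (restriction M U) X" "indep (restriction M U) Y" "card X < card Y"
  then show "\<exists>y\<in>Y - X. indep (restriction M U) (insert y X)"
    using indep_exchange[of X Y] by (auto simp: restriction_def)
qed

lemma matroid_contraction: "matroid (contraction M U)"
proof
  show "finite (ground (contraction M U))"
    using finite_ground by (simp add: contraction_def)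
  show "\<And>X. indep (contraction M U) X \<Longrightarrow> X \<subseteq> ground (contraction M U)"
    by (simp add: contraction_def)
  show "indep (contraction M U) {}"
    using basis_exists[of U] unfolding contraction_def basis_of_def by auto
next
  fix X Y
  assume *: "indep (contraction M U) X" and "Y \<subseteq> X"
  then obtain B where B: "basis_of M U B" "indep M (X \<union> B)" by (auto simp: contraction_def)
  have "indep M (Y \<union> B)" using indep_subset[OF B(2)] \<open>Y \<subseteq> X\<close> by blast
  then show "indep (contraction M U) Y" using * B \<open>Y \<subseteq> X\<close> by (auto simp: contraction_def)
next
  fix X Y
  assume X: "indep (contraction M U) X" and Y: "indep (contraction M U) Y"
    and less: "card X < card Y"
  have XU: "X \<inter> U = {}" and YU: "Y \<inter> U = {}"
    using X Y by (auto simp: contraction_def)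
  obtain B where B: "basis_of M U B" "indep M (X \<union> B)" using X by (auto simp: contraction_def)
  have YB: "indep M (Y \<union> B)"
    using Y contraction_basis_irrelevant[OF YU _ B(1)] by (auto simp: contraction_def)
  have BU: "B \<subseteq> U" using B(1) by (simp add: basis_of_def)
  have "finite X" "finite Y" "finite B" using indep_finite[OF B(2)] indep_finite[OF YB] by auto
  hence "card (X \<union> B) = card X + card B" "card (Y \<union> B) = card Y + card B"
    using XU YU BU by (auto intro!: card_Un_disjoint)
  hence "card (X \<union> B) < card (Y \<union> B)" using less by simp
  then obtain y where y: "y \<in> (Y \<union> B) - (X \<union> B)" "indep M (insert y (X \<union> B))"
    using indep_exchange[OF B(2) YB] by blast
  hence "indep (contraction M U) (insert y X)"
    using X Y B by (auto simp: contraction_def)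
  thus "\<exists>y\<in>Y - X. indep (contraction M U) (insert y X)" using y by blast
qed

end

lemma card_disjoint_split:
  assumes "finite S" "finite T" "S \<inter> T = {}" "A \<subseteq> S \<union> T"
  shows "card A = card (A \<inter> S) + card (A \<inter> T)"
proof -
  have "card ((A \<inter> S) \<union> (A \<inter> T)) = card (A \<inter> S) + card (A \<inter> T)"
    by (rule card_Un_disjoint) (use assms in auto)
  moreover have "(A \<inter> S) \<union> (A \<inter> T) = A" using assms(4) by blast
  ultimately show ?thesis by simp
qed

lemma indep_free_product_iff:
  assumes "matroid M" "matroid N" "ground M \<inter> ground N = {}"
  shows "indep (free_product M N) A \<longleftrightarrow>
    A \<subseteq> ground M \<union> ground N \<and> indep M (A \<inter> ground M) \<and>
    card A \<le> total_rank M + rank N (A \<inter> ground N)"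
proof -
  interpret M: matroid M by fact
  interpret N: matroid N by fact
  show ?thesis
  proof (cases "A \<subseteq> ground M \<union> ground N \<and> indep M (A \<inter> ground M)")
    case True
    have "card A = card (A \<inter> ground M) + card (A \<inter> ground N)"
      using card_disjoint_split[OF M.finite_ground N.finite_ground assms(3)] True by blast
    moreover have "rank M (A \<inter> ground M) = card (A \<inter> ground M)"
      using True M.rank_indep by blast
    moreover have "rank M (A \<inter> ground M) \<le> total_rank M" by (simp add: M.rank_mono)
    moreover have "rank N (A \<inter> ground N) \<le> card (A \<inter> ground N)"
      by (simp add: N.rank_le_card N.finite_ground)
    ultimately show ?thesis using True
      by (auto simp: free_product_def nullity_def rank_lack_def)
  qed (auto simp: free_product_def)
qed

lemma matroid_free_product:
  assumes "matroid M" "matroid N" "ground M \<inter> ground N = {}"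
  shows "matroid (free_product M N)"
proof -
  interpret M: matroid M by fact
  interpret N: matroid N by fact
  note iff = indep_free_product_iff[OF assms]
  show ?thesis
  proof
    show "finite (ground (free_product M N))"
      using M.finite_ground N.finite_ground by (simp add: free_product_def)
    show "\<And>X. indep (free_product M N) X \<Longrightarrow> X \<subseteq> ground (free_product M N)"
      by (simp add: free_product_def)
    show "indep (free_product M N) {}" using M.indep_empty by (simp add: iff)
  next
    fix X Y
    assume X: "indep (free_product M N) X" and YX: "Y \<subseteq> X"
    have i: "indep M (X \<inter> ground M)" using X by (simp add: iff)
    have i': "indep M (Y \<inter> ground M)" by (rule M.indep_subset[OF i]) (use YX in blast)
    have "rank M (Y \<inter> ground M) \<le> rank M (X \<inter> ground M)" using YX by (intro M.rank_mono) blast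
    moreover have "nullity N (Y \<inter> ground N) \<le> nullity N (X \<inter> ground N)"
      using YX by (intro N.nullity_mono) (auto simp: N.finite_ground)
    ultimately show "indep (free_product M N) Y"
      using X YX i' by (auto simp: free_product_def rank_lack_def)
  next
    fix X Y
    assume X: "indep (free_product M N) X" and Y: "indep (free_product M N) Y"
      and less: "card X < card Y"
    have finX: "finite X" and finY: "finite Y"
      using X Y M.finite_ground N.finite_ground finite_subset[of _ "ground M \<union> ground N"]
      by (auto simp: iff)
    have X': "X \<subseteq> ground M \<union> ground N" "indep M (X \<inter> ground M)"
        "card X \<le> total_rank M + rank N (X \<inter> ground N)"
      and Y': "Y \<subseteq> ground M \<union> ground N" "indep M (Y \<inter> ground M)"
        "card Y \<le> total_rank M + rank N (Y \<inter> ground N)"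
      using X Y by (simp_all add: iff)
    have addN: "indep (free_product M N) (insert y X)"
      if "y \<in> Y - X" "y \<in> ground N"
        "card X < total_rank M + rank N (insert y (X \<inter> ground N))" for y
    proof -
      have "insert y X \<inter> ground M = X \<inter> ground M"
        "insert y X \<inter> ground N = insert y (X \<inter> ground N)" using that assms(3) by auto
      thus ?thesis using that X' finX by (simp add: iff)
    qed
    show "\<exists>y\<in>Y - X. indep (free_product M N) (insert y X)"
    proof (cases "rank N (Y \<inter> ground N) \<le> rank N (X \<inter> ground N)")
      case False
      obtain J where J: "J \<subseteq> X \<inter> ground N" "indep N J" "card J = rank N (X \<inter> ground N)"
        using N.rank_attained by blast
      obtain K where K: "K \<subseteq> Y \<inter> ground N" "indep N K" "card K = rank N (Y \<inter> ground N)"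
        using N.rank_attained by blast
      obtain y where y: "y \<in> K - J" "indep N (insert y J)"
        using N.indep_exchange[OF J(2) K(2)] J K False by auto
      have c: "card (insert y J) = Suc (card J)" using y N.indep_finite[OF J(2)] by simp
      have "y \<notin> X"
      proof
        assume "y \<in> X"
        hence "insert y J \<subseteq> X \<inter> ground N" using y K J by blast
        from N.card_le_rank[OF y(2) this] show False using c J by simp
      qed
      have "insert y J \<subseteq> insert y (X \<inter> ground N)" using J by blast
      from N.card_le_rank[OF y(2) this] have "card X < total_rank M + rank N (insert y (X \<inter> ground N))"
        using c J X' by simp
      then show ?thesis using addN[of y] y K \<open>y \<notin> X\<close> by blast
    next
      case True
      hence lt: "card X < total_rank M + rank N (X \<inter> ground N)" using less Y' by simp
      show ?thesis
      proof (cases "Y \<inter> ground N \<subseteq> X")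
        case False
        then obtain y where y: "y \<in> Y - X" "y \<in> ground N" by blast
        have "rank N (X \<inter> ground N) \<le> rank N (insert y (X \<inter> ground N))"
          by (rule N.rank_mono) blast
        thus ?thesis using addN[OF y] y lt by auto
      next
        case True
        have "card Z = card (Z \<inter> ground M) + card (Z \<inter> ground N)"
          if "Z \<subseteq> ground M \<union> ground N" for Z
          using card_disjoint_split[OF M.finite_ground N.finite_ground assms(3) that] .
        moreover have "card (Y \<inter> ground N) \<le> card (X \<inter> ground N)"
          using True finX by (intro card_mono) auto
        ultimately have "card (X \<inter> ground M) < card (Y \<inter> ground M)"
          using less X'(1) Y'(1) by fastforce
        then obtain y where y: "y \<in> (Y \<inter> ground M) - (X \<inter> ground M)"
            "indep M (insert y (X \<inter> ground M))"
          using M.indep_exchange[OF X'(2) Y'(2)] by blast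
        have "insert y X \<inter> ground M = insert y (X \<inter> ground M)"
          "insert y X \<inter> ground N = X \<inter> ground N" using y assms(3) by auto
        moreover have "y \<in> ground M" "y \<notin> X" using y by auto
        ultimately have "indep (free_product M N) (insert y X)"
          using y(2) X'(1) lt finX by (simp add: iff)
        thus ?thesis using y by blast
      qed
    qed
  qed
qed

end

theory Submission
  imports Defs
begin

text \<open>
  Write \<open>S\<close>, \<open>T\<close> for the ground sets, \<open>A = U \<inter> S\<close>, \<open>B = U \<inter> T\<close>; then \<open>|B| = |S - A|\<close>. Both weak maps
  are the identity wherever possible and an arbitrary bijection between \<open>B\<close> and \<open>S - A\<close> elsewhere.
  For \<open>L|U \<rightarrow> M\<close>, a set of size at most \<open>\<rho>(M)\<close> is independent in \<open>L\<close> as soon as its trace on \<open>S\<close> is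
  independent in \<open>M\<close>. For \<open>L/U \<rightarrow> N\<close>, the assumption \<open>\<rho>\<^sub>L(U) = \<rho>(M)\<close> forces either \<open>B\<close> to consist of
  loops of \<open>N\<close>, or \<open>\<rho>\<^sub>M(A) + |S - A| = \<rho>(M)\<close>, so that \<open>S - A\<close> consists of coloops of \<open>M\<close>. In either
  case \<open>I\<close> independent in \<open>N\<close> gives a preimage that extends a suitable basis of \<open>U\<close> in \<open>L\<close>.
\<close>

lemma card_vimage_bij_betw:
  assumes "bij_betw f A B" "I \<subseteq> B"
  shows "card (f -` I \<inter> A) = card I"
proof -
  have "f ` (f -` I \<inter> A) = I" using assms by (auto simp: bij_betw_def)
  moreover have "inj_on f (f -` I \<inter> A)"
    using assms(1) by (auto simp: bij_betw_def intro: inj_on_subset)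
  ultimately show ?thesis by (metis card_image)
qed

context matroid
begin

lemma basis_ofI:
  assumes "C \<subseteq> U" "indep M C" "rank M U \<le> card C"
  shows "basis_of M U C"
proof -
  have "\<not> indep M (insert x C)" if "x \<in> U - C" for x
    using card_le_rank[of "insert x C" U] that assms indep_finite[OF assms(2)] by auto
  then show ?thesis using assms by (simp add: basis_of_def)
qed

text \<open>A basis of \<open>M\<close> has at most \<open>rank M A\<close> elements inside
  \<open>A\<close>, and its other elements lie in \<open>ground M - A\<close>. This turns the first
  alternative of \<open>rank_free_product_eq_cases\<close> into an equality.\<close>

lemma total_rank_le_rank_complement:
  "total_rank M \<le> rank M A + card (ground M - A)"
proof -
  obtain X where X: "X \<subseteq> ground M" "indep M X" "card X = total_rank M"
    using rank_attained by blast
  have "card X = card (X \<inter> A) + card (X - A)"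
    using indep_finite[OF X(2)] by (metis card_Int_Diff)
  moreover have "card (X \<inter> A) \<le> rank M A"
    using X(2) by (intro card_le_rank) (auto intro: indep_subset)
  moreover have "card (X - A) \<le> card (ground M - A)"
    using X(1) finite_ground by (intro card_mono) auto
  ultimately show ?thesis using X(3) by linarith
qed

text \<open>Extend \<open>X\<close> to a basis \<open>Z\<close> of \<open>M\<close>. The part of
  \<open>Z\<close> in \<open>A\<close> has at most \<open>rank M A\<close> elements, so it is
  \<open>X\<close>; the rest then has as many elements as \<open>ground M - A\<close> and must be
  all of it.\<close>

lemma indep_union_coloops:
  assumes "indep M X" "X \<subseteq> A" "card X = rank M A"
    and "rank M A + card (ground M - A) = total_rank M"
  shows "indep M (X \<union> (ground M - A))"
proof -
  obtain Y where Y: "indep M Y" "card Y = total_rank M"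
    using rank_attained by blast
  have "card X \<le> card Y" using assms Y by simp
  then obtain Z where Z: "X \<subseteq> Z" "indep M Z" "card Z = card Y"
    using augment[OF assms(1) Y(1)] by blast
  have fin: "finite Z" using Z(2) by (rule indep_finite)
  have ZS: "Z \<subseteq> ground M" using Z(2) by (rule indep_subset_ground)
  have "card (Z \<inter> A) \<le> card X"
    unfolding assms(3) using Z(2) by (intro card_le_rank) (auto intro: indep_subset)
  moreover have "X \<subseteq> Z \<inter> A" using Z(1) assms(2) by blast
  ultimately have ZA: "X = Z \<inter> A" using fin by (intro card_seteq) auto
  have "card Z = card (Z \<inter> A) + card (Z - A)" using fin by (metis card_Int_Diff)
  then have "card (ground M - A) \<le> card (Z - A)"
    using Z(3) Y(2) assms(3,4) ZA by simp
  then have "Z - A = ground M - A"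
    using ZS finite_ground by (intro card_seteq) auto
  then have "X \<union> (ground M - A) = Z" using ZA by blast
  then show ?thesis using Z(2) by simp
qed

end

lemma restriction_free_product_weak_map:
  assumes M: "matroid M" and N: "matroid N" and disj: "ground M \<inter> ground N = {}"
    and U: "U \<subseteq> ground M \<union> ground N" and card_U: "card U = card (ground M)"
  shows "\<exists>\<phi>. bijective_weak_map (restriction (free_product M N) U) M \<phi>"
proof -
  interpret M: matroid M by fact
  interpret N: matroid N by fact
  define A where "A = U \<inter> ground M"
  define B where "B = U \<inter> ground N"
  have UAB: "U = A \<union> B" "A \<inter> B = {}" "B \<inter> ground M = {}" "A \<subseteq> ground M"
    using U disj by (auto simp: A_def B_def)
  have fin: "finite A" "finite B"
    using M.finite_ground N.finite_ground by (auto simp: A_def B_def)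
  have "card U = card A + card B" using UAB fin by (simp add: card_Un_disjoint)
  then have "card B = card (ground M - A)"
    using card_U UAB(4) fin by (simp add: card_Diff_subset)
  then obtain g where g: "bij_betw g B (ground M - A)"
    using finite_same_card_bij fin M.finite_ground by blast
  define \<phi> where "\<phi> x = (if x \<in> A then x else g x)" for x
  have "bij_betw \<phi> A A" by (rule bij_betw_cong[THEN iffD1, OF _ bij_betw_id]) (simp add: \<phi>_def)
  moreover have "bij_betw \<phi> B (ground M - A)"
    by (rule bij_betw_cong[THEN iffD1, OF _ g]) (use UAB in \<open>auto simp: \<phi>_def\<close>)
  ultimately have "bij_betw \<phi> (A \<union> B) (A \<union> (ground M - A))"
    by (rule bij_betw_combine) blast
  then have bij: "bij_betw \<phi> U (ground M)" using UAB by (simp add: Un_absorb1)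
  have "indep (free_product M N) (\<phi> -` I \<inter> U)" if I: "indep M I" for I
  proof -
    \<comment> \<open>Only elements of \<open>A\<close> lie in the trace on \<open>ground M\<close>,
      and \<open>\<phi>\<close> fixes them; the choice of \<open>g\<close> is therefore
      immaterial.\<close>
    have "\<phi> -` I \<inter> U \<inter> ground M \<subseteq> I" by (auto simp: \<phi>_def A_def)
    then have "indep M (\<phi> -` I \<inter> U \<inter> ground M)" by (rule M.indep_subset[OF I])
    moreover have "card (\<phi> -` I \<inter> U) = card I"
      using bij M.indep_subset_ground[OF I] by (rule card_vimage_bij_betw)
    moreover have "card I \<le> total_rank M"
      using I M.indep_subset_ground[OF I] by (rule M.card_le_rank)
    ultimately show ?thesis
      using U by (auto simp: indep_free_product_iff[OF M N disj])
  qed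
  with bij show ?thesis
    by (auto simp: bijective_weak_map_def restriction_def)
qed

text \<open>If both alternatives failed, a largest independent set \<open>X\<close> of
  \<open>M\<close> inside \<open>U \<inter> ground M\<close>, a non-loop \<open>b\<close> of
  \<open>N\<close> in \<open>U\<close> and enough further elements of
  \<open>U \<inter> ground N\<close> would form an independent set of the free product inside
  \<open>U\<close> that exceeds the rank of \<open>U\<close>.\<close>

lemma rank_free_product_eq_cases:
  assumes M: "matroid M" and N: "matroid N" and disj: "ground M \<inter> ground N = {}"
    and U: "U \<subseteq> ground M \<union> ground N"
    and rank_U: "rank (free_product M N) U = total_rank M"
  shows "rank M (U \<inter> ground M) + card (U \<inter> ground N) \<le> total_rank M \<or>
    (\<forall>b \<in> U \<inter> ground N. \<not> indep N {b})"
proof (rule ccontr)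
  assume neg: "\<not> ?thesis"
  interpret M: matroid M by fact
  interpret N: matroid N by fact
  interpret L: matroid "free_product M N" by (rule matroid_free_product[OF M N disj])
  obtain b where b: "b \<in> U \<inter> ground N" "indep N {b}"
    and big: "total_rank M < rank M (U \<inter> ground M) + card (U \<inter> ground N)"
    using neg by auto
  obtain X where X: "X \<subseteq> U \<inter> ground M" "indep M X" "card X = rank M (U \<inter> ground M)"
    using M.rank_attained by blast
  have finX: "finite X" using X(2) by (rule M.indep_finite)
  have finB: "finite (U \<inter> ground N)" using N.finite_ground by simp
  have le: "card X \<le> total_rank M"
    using X(2) M.indep_subset_ground[OF X(2)] by (rule M.card_le_rank)
  \<comment> \<open>\<open>D\<close> is sized so that \<open>X\<close>, \<open>b\<close> and
    \<open>D\<close> together have exactly one element more than \<open>total_rank M\<close>; the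
    strict inequality \<open>big\<close> leaves enough elements after \<open>b\<close> is set
    aside.\<close>
  have "total_rank M - card X \<le> card (U \<inter> ground N - {b})"
    using big b(1) finB X(3) by (simp add: card_Diff_singleton)
  then obtain D where D: "D \<subseteq> U \<inter> ground N - {b}" "card D = total_rank M - card X" "finite D"
    by (rule obtain_subset_with_card_n)
  have "X \<inter> insert b D = {}" using X(1) D(1) b(1) disj by blast
  then have "card (X \<union> insert b D) = card X + card (insert b D)"
    using finX D(3) by (intro card_Un_disjoint) auto
  then have cardY: "card (X \<union> insert b D) = Suc (total_rank M)"
    using D le by (subst (asm) card_insert_disjoint[of D b]) auto
  have tr: "(X \<union> insert b D) \<inter> ground M = X" "(X \<union> insert b D) \<inter> ground N = insert b D"
    using X(1) D(1) b(1) disj by auto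
  \<comment> \<open>The non-loop \<open>b\<close> pays for the one element in excess of
    \<open>total_rank M\<close>.\<close>
  have "1 \<le> rank N (insert b D)" using N.card_le_rank[OF b(2), of "insert b D"] by simp
  then have "indep (free_product M N) (X \<union> insert b D)"
    unfolding indep_free_product_iff[OF M N disj] tr cardY using X D(1) b(1) by auto
  moreover have "X \<union> insert b D \<subseteq> U" using X(1) D(1) b(1) by blast
  ultimately have "card (X \<union> insert b D) \<le> total_rank M"
    unfolding rank_U[symmetric] by (rule L.card_le_rank)
  then show False using cardY by simp
qed

text \<open>The preimage of \<open>I\<close> differs from \<open>I\<close> only in that
  \<open>I \<inter> B\<close> is replaced by elements of \<open>ground M - A\<close>. The basis of
  \<open>U\<close> must make up for the missing elements and remain compatible in \<open>M\<close>
  with the new ones.\<close>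

lemma contraction_free_product_weak_map:
  assumes M: "matroid M" and N: "matroid N" and disj: "ground M \<inter> ground N = {}"
    and U: "U \<subseteq> ground M \<union> ground N" and card_U: "card U = card (ground M)"
    and rank_U: "rank (free_product M N) U = total_rank M"
  shows "\<exists>\<psi>. bijective_weak_map (contraction (free_product M N) U) N \<psi>"
proof -
  interpret M: matroid M by fact
  interpret N: matroid N by fact
  interpret L: matroid "free_product M N" by (rule matroid_free_product[OF M N disj])
  note indep_L = indep_free_product_iff[OF M N disj]
  define A where "A = U \<inter> ground M"
  define B where "B = U \<inter> ground N"
  define W where "W = ground M \<union> ground N - U"
  have UAB: "U = A \<union> B" "A \<inter> B = {}" "A \<subseteq> ground M" "B \<subseteq> ground N"
    using U disj by (auto simp: A_def B_def)
  have W: "W = (ground M - A) \<union> (ground N - B)"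
    using disj by (auto simp: W_def A_def B_def)
  have fin: "finite A" "finite B" "finite W"
    using M.finite_ground N.finite_ground by (auto simp: A_def B_def W_def)
  have "card U = card A + card B" using UAB fin by (simp add: card_Un_disjoint)
  then have card_B: "card (ground M - A) = card B"
    using card_U UAB(3) fin by (simp add: card_Diff_subset)
  then obtain f where f: "bij_betw f (ground M - A) B"
    using finite_same_card_bij fin M.finite_ground by blast
  define \<psi> where "\<psi> x = (if x \<in> ground M then f x else x)" for x
  have "bij_betw \<psi> (ground M - A) B"
    by (rule bij_betw_cong[THEN iffD1, OF _ f]) (auto simp: \<psi>_def)
  moreover have "bij_betw \<psi> (ground N - B) (ground N - B)"
    by (rule bij_betw_cong[THEN iffD1, OF _ bij_betw_id]) (use disj in \<open>auto simp: \<psi>_def\<close>)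
  ultimately have "bij_betw \<psi> W (B \<union> (ground N - B))"
    unfolding W by (rule bij_betw_combine) blast
  then have bij: "bij_betw \<psi> W (ground N)" using UAB(4) by (simp add: Un_absorb1)
  \<comment> \<open>A single basis suffices for independence in \<open>contraction\<close>, so
    \<open>C\<close> may be chosen to suit the case.\<close>
  have "\<exists>C. basis_of (free_product M N) U C \<and> indep (free_product M N) (\<psi> -` I \<inter> W \<union> C)"
    if I: "indep N I" for I
  proof -
    define J where "J = \<psi> -` I \<inter> W"
    have finJ: "finite J" using fin by (simp add: J_def)
    have JW: "J \<subseteq> ground M \<union> ground N" "J \<inter> U = {}" by (auto simp: J_def W_def)
    have "\<psi> x = x" if "x \<in> ground N" for x using that disj by (auto simp: \<psi>_def)
    then have JN: "J \<inter> ground N = I - B"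
      using disj N.indep_subset_ground[OF I] by (auto simp: J_def W)
    have card_J: "card J = card I"
      unfolding J_def using bij N.indep_subset_ground[OF I] by (rule card_vimage_bij_betw)
    \<comment> \<open>In the size bound for the free product, \<open>C\<close> uses up
      \<open>total_rank M\<close>; the remaining \<open>card J = card I\<close> is covered by the
      rank in \<open>N\<close> once the trace on \<open>ground N\<close> contains
      \<open>I\<close>.\<close>
    have indep_JC: "indep (free_product M N) (J \<union> C)"
      if C: "C \<subseteq> U" "card C = total_rank M" and CM: "indep M ((J \<union> C) \<inter> ground M)"
        and IC: "I \<subseteq> (J \<union> C) \<inter> ground N" for C
    proof -
      have "finite C" using C(1) UAB fin by (auto intro: finite_subset)
      then have "card (J \<union> C) = card I + total_rank M"
        using JW(2) C finJ card_J by (subst card_Un_disjoint) auto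
      moreover have "card I \<le> rank N ((J \<union> C) \<inter> ground N)"
        using I IC by (rule N.card_le_rank)
      ultimately show ?thesis using JW(1) C(1) CM U by (auto simp: indep_L)
    qed
    show ?thesis
    proof (cases "rank M A + card B \<le> total_rank M")
      case True
      then have eq: "rank M A + card B = total_rank M"
        using M.total_rank_le_rank_complement[of A] card_B by simp
      obtain X where X: "X \<subseteq> A" "indep M X" "card X = rank M A"
        using M.rank_attained by blast
      \<comment> \<open>Including all of \<open>B\<close> restores the elements of \<open>I\<close>
        that were pulled back to \<open>ground M - A\<close>; their replacements are coloops of
        \<open>M\<close> and can be added to \<open>X\<close>.\<close>
      define C where "C = X \<union> B"
      have CU: "C \<subseteq> U" using X(1) UAB(1) by (auto simp: C_def)
      have "card C = card X + card B" unfolding C_def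
        using X(1) UAB(2) fin M.indep_finite[OF X(2)] by (intro card_Un_disjoint) auto
      then have card_C: "card C = total_rank M" using X(3) eq by simp
      have "indep M (X \<union> (ground M - A))"
        using M.indep_union_coloops[OF X(2,1,3)] eq card_B by simp
      moreover have "(J \<union> C) \<inter> ground M \<subseteq> X \<union> (ground M - A)"
        using JW(2) UAB disj by (auto simp: C_def)
      ultimately have "indep M ((J \<union> C) \<inter> ground M)" by (rule M.indep_subset)
      moreover have "I \<subseteq> (J \<union> C) \<inter> ground N"
        using JN UAB(4) N.indep_subset_ground[OF I] by (auto simp: C_def)
      ultimately have JC: "indep (free_product M N) (J \<union> C)"
        using CU card_C by (intro indep_JC)
      then have "indep (free_product M N) C" by (rule L.indep_subset) simp
      then have "basis_of (free_product M N) U C"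
        using CU card_C rank_U by (intro L.basis_ofI) auto
      with JC show ?thesis unfolding J_def by blast
    next
      case False
      then have "\<forall>b\<in>B. \<not> indep N {b}"
        using rank_free_product_eq_cases[OF M N disj U rank_U] by (simp add: A_def B_def)
      \<comment> \<open>An independent set contains no loops, so \<open>I\<close> avoids
        \<open>B\<close>. Its preimage is then \<open>I\<close> itself, and any basis of
        \<open>U\<close> will do.\<close>
      then have IB: "I \<inter> B = {}" using N.indep_subset[OF I] by blast
      then have IJ: "I \<subseteq> J \<inter> ground N" using JN by blast
      then have "I = J" using finJ card_J by (intro card_seteq) auto
      then have JM: "J \<inter> ground M = {}" using N.indep_subset_ground[OF I] disj by blast
      obtain C where C: "basis_of (free_product M N) U C" using L.basis_exists by blast
      then have CU: "C \<subseteq> U" "indep (free_product M N) C" by (auto simp: basis_of_def)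
      have "(J \<union> C) \<inter> ground M = C \<inter> ground M" using JM by blast
      then have "indep M ((J \<union> C) \<inter> ground M)" using CU(2) by (simp add: indep_L)
      then have "indep (free_product M N) (J \<union> C)"
        using CU(1) L.basis_card[OF C] rank_U IJ by (intro indep_JC) auto
      with C show ?thesis unfolding J_def by blast
    qed
  qed
  moreover have "ground (free_product M N) - U = W" by (simp add: free_product_def W_def)
  ultimately have "bijective_weak_map (contraction (free_product M N) U) N \<psi>"
    using bij by (simp add: bijective_weak_map_def contraction_def)
  then show ?thesis by blast
qed

theorem theorem7:
  fixes M N :: "'a matroid_structure" and U :: "'a set"
  assumes "matroid M" and "matroid N" and "ground M \<inter> ground N = {}"
    and "U \<subseteq> ground M \<union> ground N"
    and "card U = card (ground M)"
    and "rank (free_product M N) U = total_rank M"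
  shows "(\<exists>\<phi>. bijective_weak_map (restriction (free_product M N) U) M \<phi>) \<and>
         (\<exists>\<psi>. bijective_weak_map (contraction (free_product M N) U) N \<psi>)"
  using restriction_free_product_weak_map[OF assms(1-5)] contraction_free_product_weak_map[OF assms]
  by blast

end
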